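(* Let $\mu\in\mathcal{M}_+$. The map $\mathcal{G}\in\mathbb{G}\mapsto\mu_{\mathcal{G}}\in\mathcal{M}_+$ is (i) increasing, i.e., if $\mathcal{G},\mathcal{H}\in\mathbb{G}$ and $\mathcal{G}\subseteq\mathcal{H}$ then $\mu_{\mathcal{G}}\le\mu_{\mathcal{H}}$; (ii) continuous from below with respect to the order, i.e., if $\{\mathcal{G}^i\}_{i\in I}\subseteq\mathbb{G}$ (with $I\neq\emptyset$) then $$\mu_{\bigvee_{i\in I}\mathcal{G}^i}=\bigvee_{i\in I}\mu_{\mathcal{G}^i}.$$
   Context: $(\Omega,\mathcal{F})$ is a measurable space, $\mathcal{M}$ is the space of real-valued (finite signed, countably additive) measures on it, ordered by $\mu\ge\nu$ iff $\mu(F)\ge\nu(F)$ for all $F\in\mathcal{F}$, and $\mathcal{M}_+$ is the set of positive finite measures. $\mathcal{M}$ is an order complete Riesz space, and $\bigvee_{i\in I}\mu_i$ denotes the supremum in $\mathcal{M}$ of a family bounded from above. $\mathbb{G}$ is the set of all non-empty families $\mathcal{G}\subseteq\mathcal{F}$ which are closed under countable unions, ordered by inclusion; $\bigvee_{i\in I}\mathcal{G}^i$ is the supremum in $\mathbb{G}$, i.e. the smallest family in $\mathbb{G}$ containing $\bigcup_{i\in I}\mathcal{G}^i$. For $\mathcal{G}\in\mathbb{G}$ and $\mu\in\mathcal{M}_+$ there exists a set $G_\mu\in\mathcal{G}$, unique up to $\mu$-null sets, such that $\mu(G\setminus G_\mu)=0$ for every $G\in\mathcal{G}$; the $\mathcal{G}$-atomic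 part of $\mu$ is $\mu_{\mathcal{G}}:=\mu(G_\mu\cap\cdot)$. *)

theory Defs
  imports "HOL-Analysis.Analysis" "HOL-Library.Lub_Glb"
begin

text \<open>
  A measure \<open>M\<close> serves here as the measurable space \<open>(space M, sets M)\<close>; a positive finite
  measure on it is some \<open>\<mu>\<close> with \<^term>\<open>finite_measure \<mu>\<close> and \<^term>\<open>sets \<mu> = sets M\<close>.

  Real-valued measures are set functions that vanish outside \<^term>\<open>sets M\<close>. This is
  the convention of \<^const>\<open>measure\<close>, so \<^term>\<open>measure \<mu>\<close> is the element of
  \<open>signed_measures M\<close> given by \<open>\<mu>\<close>. It also makes the order of the function space
  \<^typ>\<open>'a set \<Rightarrow> real\<close> agree on \<open>signed_measures M\<close> with the setwise order on
  \<^term>\<open>sets M\<close> (lemma \<open>signed_measures_le_iff\<close>), so a supremum in the space of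
  signed measures is \<^term>\<open>isLub (signed_measures M)\<close>.
\<close>

definition signed_measures :: "'a measure \<Rightarrow> ('a set \<Rightarrow> real) set" where
  "signed_measures M = {\<nu>. \<nu> {} = 0 \<and>
     (\<forall>A :: nat \<Rightarrow> 'a set. range A \<subseteq> sets M \<longrightarrow> disjoint_family A \<longrightarrow>
        (\<lambda>n. \<nu> (A n)) sums \<nu> (\<Union>n. A n)) \<and>
     (\<forall>F. F \<notin> sets M \<longrightarrow> \<nu> F = 0)}"

text \<open>
  Members need not contain the empty set: only unions of non-empty countable subfamilies count.
\<close>

definition union_closed_families :: "'a measure \<Rightarrow> 'a set set set" where
  "union_closed_families M = {G. G \<noteq> {} \<and> G \<subseteq> sets M \<and>
     (\<forall>A :: nat \<Rightarrow> 'a set. range A \<subseteq> G \<longrightarrow> (\<Union>n. A n) \<in> G)}"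

definition family_Sup :: "'a measure \<Rightarrow> 'i set \<Rightarrow> ('i \<Rightarrow> 'a set set) \<Rightarrow> 'a set set" where
  "family_Sup M I G = (\<lambda>H. H \<in> union_closed_families M) hull (\<Union>i\<in>I. G i)"

definition is_atomic_support :: "'a measure \<Rightarrow> 'a set set \<Rightarrow> 'a set \<Rightarrow> bool" where
  "is_atomic_support \<mu> G A \<longleftrightarrow> A \<in> G \<and> (\<forall>B\<in>G. B - A \<in> null_sets \<mu>)"

definition atomic_support :: "'a measure \<Rightarrow> 'a set set \<Rightarrow> 'a set" where
  "atomic_support \<mu> G = (SOME A. is_atomic_support \<mu> G A)"

text \<open>
  The density is the indicator of the chosen support, which gives the measure
  \<open>\<mu> (atomic_support \<mu> G \<inter> \<cdot>)\<close>; see lemma \<open>measure_atomic_part\<close>, also for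
  independence of the choice.
\<close>

definition atomic_part :: "'a measure \<Rightarrow> 'a set set \<Rightarrow> 'a measure" where
  "atomic_part \<mu> G = density \<mu> (indicator (atomic_support \<mu> G))"

lemma measure_in_signed_measures:
  assumes "finite_measure \<mu>" "sets \<mu> = sets M"
  shows "measure \<mu> \<in> signed_measures M"
proof -
  interpret finite_measure \<mu> by fact
  show ?thesis
    using assms(2) finite_measure_UNION
    by (auto simp: signed_measures_def measure_notin_sets)
qed

lemma signed_measures_le_iff:
  assumes "\<nu> \<in> signed_measures M" "\<nu>' \<in> signed_measures M"
  shows "\<nu> \<le> \<nu>' \<longleftrightarrow> (\<forall>F\<in>sets M. \<nu> F \<le> \<nu>' F)"
proof
  assume "\<forall>F\<in>sets M. \<nu> F \<le> \<nu>' F"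
  then show "\<nu> \<le> \<nu>'"
    using assms unfolding le_fun_def signed_measures_def by (metis (mono_tags, lifting) mem_Collect_eq order_refl)
qed (simp add: le_fun_def)

lemma family_Sup_least:
  fixes G :: "'i \<Rightarrow> 'a set set"
  assumes "I \<noteq> {}" "\<And>i. i \<in> I \<Longrightarrow> G i \<in> union_closed_families M"
  shows "family_Sup M I G \<in> union_closed_families M"
    and "\<And>i. i \<in> I \<Longrightarrow> G i \<subseteq> family_Sup M I G"
    and "\<And>H. H \<in> union_closed_families M \<Longrightarrow> (\<And>i. i \<in> I \<Longrightarrow> G i \<subseteq> H) \<Longrightarrow> family_Sup M I G \<subseteq> H"
proof -
  show upper: "\<And>i. i \<in> I \<Longrightarrow> G i \<subseteq> family_Sup M I G"
    unfolding family_Sup_def hull_def by auto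
  show least: "\<And>H. H \<in> union_closed_families M \<Longrightarrow> (\<And>i. i \<in> I \<Longrightarrow> G i \<subseteq> H) \<Longrightarrow> family_Sup M I G \<subseteq> H"
    unfolding family_Sup_def by (intro hull_minimal UN_least)
  obtain i where i: "i \<in> I" using assms(1) by auto
  have ne: "family_Sup M I G \<noteq> {}"
    using upper[OF i] assms(2)[OF i] by (auto simp: union_closed_families_def)
  have "sets M \<in> union_closed_families M"
    by (auto simp: union_closed_families_def)
  then have sub: "family_Sup M I G \<subseteq> sets M"
    using assms(2) by (intro least) (auto simp: union_closed_families_def)
  have "(\<Union>n. A n) \<in> family_Sup M I G" if "range A \<subseteq> family_Sup M I G" for A :: "nat \<Rightarrow> 'a set"
    unfolding family_Sup_def hull_def
  proof (safe, goal_cases)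
    case (1 H)
    then have "family_Sup M I G \<subseteq> H" by (intro least) auto
    then have "range A \<subseteq> H" using that by auto
    then show ?case using 1 by (auto simp: union_closed_families_def)
  qed
  then show "family_Sup M I G \<in> union_closed_families M"
    using ne sub by (simp add: union_closed_families_def)
qed

lemma ex_atomic_support:
  fixes \<mu> :: "'a measure"
  assumes "finite_measure \<mu>" "G \<in> union_closed_families \<mu>"
  shows "\<exists>A. is_atomic_support \<mu> G A"
proof -
  interpret finite_measure \<mu> by fact
  have G: "G \<noteq> {}" "G \<subseteq> sets \<mu>"
    and un: "\<And>A :: nat \<Rightarrow> 'a set. range A \<subseteq> G \<Longrightarrow> (\<Union>n. A n) \<in> G"
    using assms(2) by (auto simp: union_closed_families_def)
  have un2: "A \<union> B \<in> G" if "A \<in> G" "B \<in> G" for A B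
  proof -
    have "(\<Union>n::nat. if n = 0 then A else B) = A \<union> B"
      by (auto split: if_splits intro: exI[of _ "1::nat"])
    then show ?thesis using un[of "\<lambda>n. if n = 0 then A else B"] that by auto
  qed
  define s where "s = (SUP A\<in>G. measure \<mu> A)"
  have bdd: "bdd_above (measure \<mu> ` G)"
    by (rule bdd_aboveI2[where M = "measure \<mu> (space \<mu>)"]) (rule bounded_measure)
  have "\<exists>A\<in>G. s - 1 / real (Suc n) < measure \<mu> A" for n
  proof -
    have "s - 1 / real (Suc n) < s" by simp
    then show ?thesis unfolding s_def using less_cSUP_iff[OF G(1) bdd] by blast
  qed
  then obtain A where A: "\<And>n. A n \<in> G" "\<And>n. s - 1 / real (Suc n) < measure \<mu> (A n)"
    by metis
  define U where "U = (\<Union>n. A n)"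
  have U: "U \<in> G" unfolding U_def using A(1) by (intro un) auto
  have Us: "s \<le> measure \<mu> U"
  proof (rule field_le_epsilon)
    fix e :: real assume "e > 0"
    then obtain n where "1 / real (Suc n) < e" using nat_approx_posE by blast
    moreover have "measure \<mu> (A n) \<le> measure \<mu> U"
      using U G(2) by (intro finite_measure_mono) (auto simp: U_def)
    ultimately show "s \<le> measure \<mu> U + e" using A(2)[of n] by linarith
  qed
  have "B - U \<in> null_sets \<mu>" if B: "B \<in> G" for B
  proof -
    have m: "U \<in> sets \<mu>" "B \<in> sets \<mu>" using U B G(2) by auto
    have "measure \<mu> (U \<union> B) \<le> s"
      unfolding s_def using un2[OF U B] bdd by (rule cSUP_upper)
    moreover have "measure \<mu> (U \<union> B) = measure \<mu> U + measure \<mu> (B - U)"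
      using finite_measure_Union[of U "B - U"] m by auto
    ultimately have "measure \<mu> (B - U) = 0"
      using Us measure_nonneg[of \<mu> "B - U"] by linarith
    then show ?thesis using m by (simp add: null_sets_def emeasure_eq_measure)
  qed
  then show ?thesis using U by (auto simp: is_atomic_support_def)
qed

lemma finite_measure_atomic_part:
  assumes "finite_measure \<mu>" "G \<in> union_closed_families \<mu>"
  shows "finite_measure (atomic_part \<mu> G)" "sets (atomic_part \<mu> G) = sets \<mu>"
proof -
  interpret finite_measure \<mu> by fact
  have "is_atomic_support \<mu> G (atomic_support \<mu> G)"
    unfolding atomic_support_def using ex_atomic_support[OF assms] by (rule someI_ex)
  then have "atomic_support \<mu> G \<in> sets \<mu>"
    using assms(2) by (auto simp: is_atomic_support_def union_closed_families_def)
  then show "finite_measure (atomic_part \<mu> G)"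
    unfolding atomic_part_def by (rule finite_measure_restricted)
qed (simp add: atomic_part_def)

lemma measure_atomic_part:
  assumes "finite_measure \<mu>" "G \<in> union_closed_families \<mu>"
    and A: "is_atomic_support \<mu> G A" and F: "F \<in> sets \<mu>"
  shows "measure (atomic_part \<mu> G) F = measure \<mu> (A \<inter> F)"
proof -
  interpret finite_measure \<mu> by fact
  define S where "S = atomic_support \<mu> G"
  have S: "is_atomic_support \<mu> G S"
    unfolding S_def atomic_support_def using ex_atomic_support[OF assms(1,2)] by (rule someI_ex)
  have m: "S \<in> sets \<mu>" "A \<in> sets \<mu>"
    using S A assms(2) by (auto simp: is_atomic_support_def union_closed_families_def)
  have "A - S \<in> null_sets \<mu>" "S - A \<in> null_sets \<mu>"
    using S A by (auto simp: is_atomic_support_def)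
  then have "AE x in \<mu>. x \<notin> A - S" "AE x in \<mu>. x \<notin> S - A"
    by (simp_all only: AE_not_in)
  then have "AE x in \<mu>. x \<in> S \<inter> F \<longleftrightarrow> x \<in> A \<inter> F"
    by eventually_elim auto
  then have "emeasure \<mu> (S \<inter> F) = emeasure \<mu> (A \<inter> F)"
    using m F by (intro emeasure_eq_AE) auto
  then show ?thesis
    unfolding atomic_part_def S_def[symmetric] measure_def
    using emeasure_restricted[OF m(1) F] by simp
qed

end

(* The least-upper-bound half rests on one auxiliary family: for a signed measure \<nu>, the
   measurable sets on all of whose measurable subsets \<mu> is dominated by \<nu> are closed under
   countable unions. If \<nu> dominates every \<mu>_{G^i}, this family contains every G^i, hence their
   supremum and in particular the support G of the supremum. So \<mu> is dominated by \<nu> inside G,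
   while outside G positivity of \<nu> suffices. *)

theory Submission
  imports Defs
begin

lemma is_atomic_support_atomic_support:
  assumes "finite_measure \<mu>" "G \<in> union_closed_families \<mu>"
  shows "is_atomic_support \<mu> G (atomic_support \<mu> G)"
  unfolding atomic_support_def using ex_atomic_support[OF assms] by (rule someI_ex)

text \<open>The support of the smaller family is itself a member of the larger family, so the
  support of the latter covers it up to a \<open>\<mu>\<close>-null set.\<close>

lemma measure_atomic_part_mono:
  assumes fin: "finite_measure \<mu>"
    and G: "G \<in> union_closed_families \<mu>" and H: "H \<in> union_closed_families \<mu>"
    and "G \<subseteq> H"
  shows "measure (atomic_part \<mu> G) \<le> measure (atomic_part \<mu> H)"
proof (rule le_funI)
  interpret finite_measure \<mu> by fact
  fix F
  define A B where "A = atomic_support \<mu> G" and "B = atomic_support \<mu> H"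
  have A: "is_atomic_support \<mu> G A" and B: "is_atomic_support \<mu> H B"
    unfolding A_def B_def using fin G H by (auto intro: is_atomic_support_atomic_support)
  show "measure (atomic_part \<mu> G) F \<le> measure (atomic_part \<mu> H) F"
  proof (cases "F \<in> sets \<mu>")
    case True
    have m: "B \<in> sets \<mu>"
      using B H by (auto simp: is_atomic_support_def union_closed_families_def)
    have "A - B \<in> null_sets \<mu>"
      using A B \<open>G \<subseteq> H\<close> by (auto simp: is_atomic_support_def)
    then have "AE x in \<mu>. x \<notin> A - B"
      by (rule AE_not_in)
    then have "AE x in \<mu>. x \<in> A \<inter> F \<longrightarrow> x \<in> B \<inter> F"
      by eventually_elim auto
    then have "measure \<mu> (A \<inter> F) \<le> measure \<mu> (B \<inter> F)"
      using m True by (intro finite_measure_mono_AE) auto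
    then show ?thesis
      using measure_atomic_part[OF fin G A True] measure_atomic_part[OF fin H B True] by simp
  next
    \<comment> \<open>The order on set functions compares all sets. Outside
      \<open>sets \<mu>\<close> both sides take the default value 0 of
      \<open>measure\<close>.\<close>
    case False
    then show ?thesis
      by (simp add: measure_notin_sets atomic_part_def)
  qed
qed

text \<open>The support covers every member up to a null set, so inside a member no mass is lost.
  This turns bounds on atomic parts into bounds on \<open>\<mu>\<close> itself.\<close>

lemma measure_atomic_part_subset_member:
  assumes fin: "finite_measure \<mu>" and G: "G \<in> union_closed_families \<mu>"
    and "A \<in> G" "F \<in> sets \<mu>" "F \<subseteq> A"
  shows "measure (atomic_part \<mu> G) F = measure \<mu> F"
proof -
  interpret finite_measure \<mu> by fact
  define S where "S = atomic_support \<mu> G"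
  have S: "is_atomic_support \<mu> G S"
    unfolding S_def using fin G by (rule is_atomic_support_atomic_support)
  have m: "S \<in> sets \<mu>"
    using S G by (auto simp: is_atomic_support_def union_closed_families_def)
  have "A - S \<in> null_sets \<mu>"
    using S \<open>A \<in> G\<close> by (auto simp: is_atomic_support_def)
  then have "AE x in \<mu>. x \<notin> A - S"
    by (rule AE_not_in)
  then have "AE x in \<mu>. x \<in> S \<inter> F \<longleftrightarrow> x \<in> F"
    by eventually_elim (use \<open>F \<subseteq> A\<close> in auto)
  then have "measure \<mu> (S \<inter> F) = measure \<mu> F"
    using m \<open>F \<in> sets \<mu>\<close> by (intro measure_eq_AE) auto
  then show ?thesis
    using measure_atomic_part[OF fin G S \<open>F \<in> sets \<mu>\<close>] by simp
qed

lemma signed_measures_Un_disjoint: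
  fixes A B :: "'a set"
  assumes \<nu>: "\<nu> \<in> signed_measures M"
    and "A \<in> sets M" "B \<in> sets M" and "A \<inter> B = {}"
  shows "\<nu> (A \<union> B) = \<nu> A + \<nu> B"
proof -
  \<comment> \<open>Countable additivity is applied to the sequence \<open>A\<close>,
    \<open>B\<close>, \<open>{}\<close>, \<open>{}\<close>, ..., whose series collapses to two terms
    because \<open>\<nu> {} = 0\<close>.\<close>
  have "range (binaryset A B) \<subseteq> sets M" "disjoint_family (binaryset A B)"
    using assms by (auto simp: range_binaryset_eq disjoint_family_on_def binaryset_def)
  moreover have "(\<lambda>n. \<nu> (C n)) sums \<nu> (\<Union>n. C n)"
    if "range C \<subseteq> sets M" "disjoint_family C" for C :: "nat \<Rightarrow> 'a set"
    using \<nu> that by (simp add: signed_measures_def)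
  ultimately have "(\<lambda>n. \<nu> (binaryset A B n)) sums \<nu> (A \<union> B)"
    unfolding UN_binaryset_eq[symmetric] by blast
  moreover have "(\<lambda>n. \<nu> (binaryset A B n)) sums (\<nu> A + \<nu> B)"
    using \<nu> by (intro binaryset_sums) (simp add: signed_measures_def)
  ultimately show ?thesis
    by (rule sums_unique2)
qed

text \<open>Domination on \<open>A\<close> alone would not survive unions, since signed measures
  need not be monotone. Asking for it on all measurable subsets lets a subset of the union be cut
  into disjoint pieces, each dominated, and the inequalities be summed.\<close>

lemma dominated_sets_union_closed:
  assumes \<nu>: "\<nu> \<in> signed_measures M" and \<nu>': "\<nu>' \<in> signed_measures M"
  shows "{A \<in> sets M. \<forall>F\<in>sets M. F \<subseteq> A \<longrightarrow> \<nu>' F \<le> \<nu> F} \<in> union_closed_families M"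
    (is "?D \<in> _")
proof -
  have "{} \<in> ?D"
    using \<nu> \<nu>' by (auto simp: signed_measures_def)
  moreover have "(\<Union>n. A n) \<in> ?D" if A: "range A \<subseteq> ?D" for A :: "nat \<Rightarrow> 'a set"
  proof -
    have m: "range A \<subseteq> sets M" using A by auto
    have "\<nu>' F \<le> \<nu> F" if F: "F \<in> sets M" "F \<subseteq> (\<Union>n. A n)" for F
    proof -
      \<comment> \<open>These pieces partition \<open>F\<close>, and each lies inside a single
        \<open>A n\<close>, where domination is known.\<close>
      define B where "B n = F \<inter> disjointed A n" for n
      have B: "B n \<in> sets M" "B n \<subseteq> A n" for n
        using sets.range_disjointed_sets[OF m] F(1) disjointed_subset[of A n]
        by (auto simp: B_def)
      have "(\<Union>n. B n) = F"
        using F(2) UN_disjointed_eq[of A] by (auto simp: B_def)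
      moreover have "disjoint_family B"
        using disjoint_family_disjointed[of A]
        by (auto simp: B_def disjoint_family_on_def)
      ultimately have "(\<lambda>n. \<nu>' (B n)) sums \<nu>' F" "(\<lambda>n. \<nu> (B n)) sums \<nu> F"
        using \<nu> \<nu>' B(1) unfolding signed_measures_def by (auto simp: image_subset_iff)
      moreover have "\<nu>' (B n) \<le> \<nu> (B n)" for n
        using A B[of n] by auto
      ultimately show ?thesis
        by (rule sums_le[rotated])
    qed
    then show ?thesis
      using m by auto
  qed
  ultimately show ?thesis
    unfolding union_closed_families_def by blast
qed

lemma measure_atomic_part_family_Sup_le:
  assumes fin: "finite_measure \<mu>" and I: "I \<noteq> {}"
    and G: "\<And>i. i \<in> I \<Longrightarrow> G i \<in> union_closed_families \<mu>"
    and \<nu>: "\<nu> \<in> signed_measures \<mu>"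
    and ub: "\<And>i. i \<in> I \<Longrightarrow> measure (atomic_part \<mu> (G i)) \<le> \<nu>"
  shows "measure (atomic_part \<mu> (family_Sup \<mu> I G)) \<le> \<nu>"
proof (rule le_funI)
  define S where "S = atomic_support \<mu> (family_Sup \<mu> I G)"
  define D where "D = {A \<in> sets \<mu>. \<forall>F\<in>sets \<mu>. F \<subseteq> A \<longrightarrow> measure \<mu> F \<le> \<nu> F}"
  have Sup: "family_Sup \<mu> I G \<in> union_closed_families \<mu>"
    using I G by (rule family_Sup_least(1))
  have S: "is_atomic_support \<mu> (family_Sup \<mu> I G) S"
    unfolding S_def using fin Sup by (rule is_atomic_support_atomic_support)
  have "D \<in> union_closed_families \<mu>"
    unfolding D_def by (intro dominated_sets_union_closed \<nu> measure_in_signed_measures fin refl)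
  moreover have "G i \<subseteq> D" if i: "i \<in> I" for i
  proof
    fix A assume A: "A \<in> G i"
    \<comment> \<open>Inside a member of \<open>G i\<close> the atomic part agrees with
      \<open>\<mu>\<close>, so the upper bound property bounds \<open>\<mu>\<close>
      directly.\<close>
    have "measure \<mu> F \<le> \<nu> F" if "F \<in> sets \<mu>" "F \<subseteq> A" for F
      using le_funD[OF ub[OF i], of F] measure_atomic_part_subset_member[OF fin G[OF i] A that]
      by simp
    then show "A \<in> D"
      using A G[OF i] by (auto simp: D_def union_closed_families_def)
  qed
  ultimately have "family_Sup \<mu> I G \<subseteq> D"
    by (intro family_Sup_least(3)[OF I G])
  \<comment> \<open>The support is chosen as a member of the supremum family, so the inclusion
    applies to it.\<close>
  then have SD: "S \<in> D"
    using S by (auto simp: is_atomic_support_def)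
  obtain i where i: "i \<in> I" using I by auto
  \<comment> \<open>\<open>\<nu>\<close> is only a signed measure; its positivity comes from
    dominating one atomic part, which exists because \<open>I\<close> is non-empty.\<close>
  have nonneg: "0 \<le> \<nu> F" for F
    using le_funD[OF ub[OF i], of F] measure_nonneg order_trans by blast
  fix F
  show "measure (atomic_part \<mu> (family_Sup \<mu> I G)) F \<le> \<nu> F"
  proof (cases "F \<in> sets \<mu>")
    case True
    have m: "S \<inter> F \<in> sets \<mu>" "F - S \<in> sets \<mu>"
      using SD True by (auto simp: D_def)
    have "measure (atomic_part \<mu> (family_Sup \<mu> I G)) F = measure \<mu> (S \<inter> F)"
      by (rule measure_atomic_part[OF fin Sup S True])
    also have "\<dots> \<le> \<nu> (S \<inter> F)"
      using SD m by (auto simp: D_def)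
    \<comment> \<open>The atomic part has no mass on \<open>F - S\<close>, so there it is enough
      that \<open>\<nu>\<close> is non-negative.\<close>
    also have "\<dots> \<le> \<nu> (S \<inter> F) + \<nu> (F - S)"
      using nonneg by simp
    also have "\<dots> = \<nu> ((S \<inter> F) \<union> (F - S))"
      by (intro signed_measures_Un_disjoint[OF \<nu> m, symmetric]) auto
    also have "(S \<inter> F) \<union> (F - S) = F"
      by auto
    finally show ?thesis .
  next
    case False
    then show ?thesis
      using nonneg by (simp add: measure_notin_sets atomic_part_def)
  qed
qed

theorem proposition7p3:
  fixes \<mu> :: "'a measure"
  assumes "finite_measure \<mu>"
  shows "(\<forall>\<G> \<H>. \<G> \<in> union_closed_families \<mu> \<longrightarrow> \<H> \<in> union_closed_families \<mu> \<longrightarrow> \<G> \<subseteq> \<H> \<longrightarrow>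
            measure (atomic_part \<mu> \<G>) \<le> measure (atomic_part \<mu> \<H>)) \<and>
         (\<forall>(I :: 'i set) \<G>. I \<noteq> {} \<longrightarrow> (\<forall>i\<in>I. \<G> i \<in> union_closed_families \<mu>) \<longrightarrow>
            isLub (signed_measures \<mu>)
              ((\<lambda>i. measure (atomic_part \<mu> (\<G> i))) ` I)
              (measure (atomic_part \<mu> (family_Sup \<mu> I \<G>))))"
proof (intro conjI allI impI)
  fix G H
  assume "G \<in> union_closed_families \<mu>" "H \<in> union_closed_families \<mu>" "G \<subseteq> H"
  with assms show "measure (atomic_part \<mu> G) \<le> measure (atomic_part \<mu> H)"
    by (rule measure_atomic_part_mono)
next
  fix I :: "'i set" and G
  assume I: "I \<noteq> {}" and "\<forall>i\<in>I. G i \<in> union_closed_families \<mu>"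
  then have G: "G i \<in> union_closed_families \<mu>" if "i \<in> I" for i
    using that by blast
  note Sup = family_Sup_least[OF I G]
  have "measure (atomic_part \<mu> (family_Sup \<mu> I G)) \<in> signed_measures \<mu>"
    using finite_measure_atomic_part[OF assms Sup(1)] by (intro measure_in_signed_measures)
  \<comment> \<open>The upper bound half is monotonicity, applied to the inclusion of
    \<open>G i\<close> in the supremum family.\<close>
  moreover have "measure (atomic_part \<mu> (G i)) \<le> measure (atomic_part \<mu> (family_Sup \<mu> I G))"
    if "i \<in> I" for i
    using that by (intro measure_atomic_part_mono assms G Sup(1,2))
  moreover have "measure (atomic_part \<mu> (family_Sup \<mu> I G)) \<le> \<nu>"
    if "\<nu> \<in> signed_measures \<mu>" "\<And>i. i \<in> I \<Longrightarrow> measure (atomic_part \<mu> (G i)) \<le> \<nu>" for \<nu>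
    using assms I G that by (rule measure_atomic_part_family_Sup_le)
  ultimately show "isLub (signed_measures \<mu>) ((\<lambda>i. measure (atomic_part \<mu> (G i))) ` I)
      (measure (atomic_part \<mu> (family_Sup \<mu> I G)))"
    unfolding isLub_def leastP_def isUb_def setle_def setge_def by blast
qed

end
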